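(* (Taylor theorem.) Let $x$ be a non-uniform lattice, $a,\gamma\in\mathbb{C}$, let $k\ge1$ be an integer, and let $f:\{a-k+1,\dots,a,a+1,\dots\}\to\mathbb{C}$. Then for every $z\in\{a+1,a+2,\dots\}$ $$\nabla_\gamma^{-k}\nabla_\gamma^{k}f(z)=f(z)-\sum_{j=0}^{k-1}\frac{1}{[j]_q!}\,\nabla_{\gamma+k-j}^{j}f(a)\,[x_{\gamma+k-1}(z)-x_{\gamma+k-1}(a)]^{(j)},$$ where $\nabla^j_{\gamma+k-j}f(a)$ is the value of $\nabla^j_{\gamma+k-j}f$ at $a$, and $\nabla^0f=f$.
   Context: Non-uniform lattice: a function $x:\mathbb{C}\to\mathbb{C}$ of one of the two forms (Q) $x(s)=\tilde c_1s^2+\tilde c_2s+\tilde c_3$ with $\tilde c_1\tilde c_2\neq0$, or (q) $x(s)=c_1q^{s}+c_2q^{-s}+c_3$ with $c_1c_2\ne0$, where $q\in\mathbb{C}\setminus\{0\}$, $|q|\neq1$, a value of $\log q$ is fixed and $q^s=e^{s\log q}$. For $\nu\in\mathbb{C}$, $x_\nu(s)=x(s+\nu/2)$. $\nabla F(s)=F(s)-F(s-1)$. $[\mu]_q=\mu$ in case (Q) and $[\mu]_q=\frac{q^{\mu/2}-q^{-\mu/2}}{q^{1/2}-q^{-1/2}}$ in case (q); $[j]_q!=\prod_{i=1}^j[i]_q$, $[0]_q!=1$. Generalized power for an integer $n\ge0$: $[x_\nu(s)-x_\nu(z)]^{(n)}=\prod_{i=0}^{n-1}[x_\nu(s)-x_\nu(z-i)]$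 (equal to $1$ for $n=0$). Differences: $\nabla_\gamma F(z)=\nabla F(z)/\nabla x_\gamma(z)$ and $\nabla_\gamma^kF(z)=\frac{\nabla}{\nabla x_\gamma(z)}\Big(\frac{\nabla}{\nabla x_{\gamma+1}(z)}\cdots\Big(\frac{\nabla F(z)}{\nabla x_{\gamma+k-1}(z)}\Big)\Big)$. Integer sums based at $a$: for $k\ge 1$, $$\nabla_\gamma^{-k}h(z)=\frac{1}{[k-1]_q!}\sum_{t=a+1}^{z}[x_{\gamma+k-1}(z)-x_{\gamma+k-1}(t-1)]^{(k-1)}h(t)\,\nabla x_\gamma(t).$$ Equivalently $\nabla_\gamma^{-1}h(z)=\sum_{t=a+1}^zh(t)\nabla x_\gamma(t)$ and $\nabla_\gamma^{-k}h=\nabla_{\gamma+k-1}^{-1}[\nabla_\gamma^{-(k-1)}h]$. Convention: all increments $\nabla x_\rho(s)$ occurring as denominators are assumed nonzero. *)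

theory Defs
  imports Complex_Main
begin

(* In QLattice q l c1 c2 c3 the parameter l is the fixed value of log q, which also fixes
   all powers of q; the bracket depends on the case and on l, so a lattice is
   represented by its parameters rather than by the bare function x. *)
datatype lattice =
    QuadLattice complex complex complex
  | QLattice complex complex complex complex complex

fun nonuniform_lattice :: "lattice \<Rightarrow> bool" where
  "nonuniform_lattice (QuadLattice c1 c2 c3) \<longleftrightarrow> c1 * c2 \<noteq> 0"
| "nonuniform_lattice (QLattice q l c1 c2 c3) \<longleftrightarrow>
     q \<noteq> 0 \<and> norm q \<noteq> 1 \<and> exp l = q \<and> c1 * c2 \<noteq> 0"

definition cpow :: "complex \<Rightarrow> complex \<Rightarrow> complex" where
  "cpow l s = exp (s * l)"

fun lat :: "lattice \<Rightarrow> complex \<Rightarrow> complex" where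
  "lat (QuadLattice c1 c2 c3) s = c1 * s ^ 2 + c2 * s + c3"
| "lat (QLattice q l c1 c2 c3) s = c1 * cpow l s + c2 * cpow l (- s) + c3"

definition lat_shift :: "lattice \<Rightarrow> complex \<Rightarrow> complex \<Rightarrow> complex" where
  "lat_shift X \<nu> s = lat X (s + \<nu> / 2)"

fun bracket :: "lattice \<Rightarrow> complex \<Rightarrow> complex" where
  "bracket (QuadLattice c1 c2 c3) \<mu> = \<mu>"
| "bracket (QLattice q l c1 c2 c3) \<mu> =
     (cpow l (\<mu> / 2) - cpow l (- \<mu> / 2)) / (cpow l (1 / 2) - cpow l (- 1 / 2))"

definition bracket_fact :: "lattice \<Rightarrow> nat \<Rightarrow> complex" where
  "bracket_fact X j = (\<Prod>i = 1..j. bracket X (of_nat i))"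

(* The generalized power [x_nu(s) - x_nu(z)]^(n). *)
definition gen_power :: "lattice \<Rightarrow> complex \<Rightarrow> complex \<Rightarrow> complex \<Rightarrow> nat \<Rightarrow> complex" where
  "gen_power X \<nu> s z n = (\<Prod>i<n. lat_shift X \<nu> s - lat_shift X \<nu> (z - of_nat i))"

definition nabla :: "(complex \<Rightarrow> complex) \<Rightarrow> complex \<Rightarrow> complex" where
  "nabla F s = F s - F (s - 1)"

definition nabla_lat ::
  "lattice \<Rightarrow> complex \<Rightarrow> (complex \<Rightarrow> complex) \<Rightarrow> complex \<Rightarrow> complex" where
  "nabla_lat X \<gamma> F z = nabla F z / nabla (lat_shift X \<gamma>) z"

(* The outermost quotient has index gamma, the innermost gamma + k - 1. *)
fun nabla_pow ::
  "lattice \<Rightarrow> complex \<Rightarrow> nat \<Rightarrow> (complex \<Rightarrow> complex) \<Rightarrow> complex \<Rightarrow> complex" where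
  "nabla_pow X \<gamma> 0 F = F"
| "nabla_pow X \<gamma> (Suc k) F = nabla_lat X \<gamma> (nabla_pow X (\<gamma> + 1) k F)"

(* The finite set {a+1, a+2, ..., z}; it is empty unless z - a is a positive integer. *)
definition steps :: "complex \<Rightarrow> complex \<Rightarrow> complex set" where
  "steps a z = {t. \<exists>m n. t = a + of_nat (Suc m) \<and> z = t + of_nat n}"

(* The k-fold sum based at a, for k >= 1 (k = 0 is not meaningful here). *)
definition nabla_sum ::
  "lattice \<Rightarrow> complex \<Rightarrow> complex \<Rightarrow> nat \<Rightarrow> (complex \<Rightarrow> complex) \<Rightarrow> complex \<Rightarrow> complex" where
  "nabla_sum X a \<gamma> k h z =
     1 / bracket_fact X (k - 1) *
     (\<Sum>t\<in>steps a z. gen_power X (\<gamma> + of_nat k - 1) z (t - 1) (k - 1)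
                      * h t * nabla (lat_shift X \<gamma>) t)"

(* For z in {a+1, a+2, ...}: the increments that occur as denominators when the k-th
   difference of index gamma is evaluated on {a+1, ..., z} and the j-th difference of index
   gamma + k - j is evaluated at a (j < k).  These are exactly the increments of
   x_(gamma+i), i < k, at the points a-i+1, ..., z. *)
definition increments_nonzero ::
  "lattice \<Rightarrow> complex \<Rightarrow> complex \<Rightarrow> nat \<Rightarrow> complex \<Rightarrow> bool" where
  "increments_nonzero X a \<gamma> k z \<longleftrightarrow>
     (\<forall>i<k. \<forall>s\<in>steps (a - of_nat i) z. nabla (lat_shift X (\<gamma> + of_nat i)) s \<noteq> 0)"

end

theory Submission
  imports Defs
begin

text \<open>
  Induction on \<open>k\<close>. The outermost quotient of \<open>\<nabla>\<^sub>\<gamma>\<^sup>k f\<close> cancels against \<open>\<nabla>x\<^sub>\<gamma>(t)\<close>, so summation by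
  parts applies; its upper boundary term vanishes, its lower one is the Taylor term of index \<open>k - 1\<close>.
  Since the generalized power telescopes and \<open>x(s + \<mu>/2) - x(s - \<mu>/2) = [\<mu>]\<^sub>q (x(s + 1/2) - x(s - 1/2))\<close>,
  the remaining sum is the one for \<open>k - 1\<close> and \<open>\<gamma> + 1\<close>.
\<close>

lemma cpow_add: "cpow l (s + t) = cpow l s * cpow l t"
  by (simp add: cpow_def ring_distribs exp_add)

lemma cpow_diff: "cpow l (s - t) = cpow l s * cpow l (- t)"
  using cpow_add[of l s "- t"] by simp

text \<open>Because |q| differs from 1, Re l is nonzero, so the two powers have the different moduli
  exp(n Re l / 2) and exp(- n Re l / 2). The case n = 1 covers the denominator of the q-bracket,
  general n its numerator.\<close>

lemma cpow_half_diff_nonzero: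
  assumes "norm (exp l) \<noteq> 1" and "n \<noteq> 0"
  shows "cpow l (of_nat n / 2) - cpow l (- of_nat n / 2) \<noteq> 0"
proof
  assume "cpow l (of_nat n / 2) - cpow l (- of_nat n / 2) = 0"
  then have "norm (exp (of_nat n / 2 * l)) = norm (exp (- (of_nat n / 2) * l))"
    by (simp add: cpow_def)
  then have "real n / 2 * Re l = - (real n / 2 * Re l)"
    by (simp add: norm_exp_eq_Re)
  with assms show False
    by (simp add: norm_exp_eq_Re)
qed

lemma bracket_of_nat_nonzero:
  assumes "nonuniform_lattice X" and "n \<noteq> 0"
  shows "bracket X (of_nat n) \<noteq> 0"
  using assms cpow_half_diff_nonzero[of _ n] cpow_half_diff_nonzero[of _ 1]
  by (cases X) auto

lemma bracket_fact_Suc: "bracket_fact X (Suc n) = bracket_fact X n * bracket X (of_nat (Suc n))"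
  by (simp add: bracket_fact_def)

lemma lat_symmetric_difference:
  assumes "nonuniform_lattice X"
  shows "lat X (s + \<mu> / 2) - lat X (s - \<mu> / 2) = bracket X \<mu> * (lat X (s + 1 / 2) - lat X (s - 1 / 2))"
proof (cases X)
  case (QuadLattice c1 c2 c3)
  then show ?thesis
    by (simp add: power2_eq_square field_simps)
next
  case (QLattice q l c1 c2 c3)
  define d where "d \<mu> = cpow l (\<mu> / 2) - cpow l (- (\<mu> / 2))" for \<mu>
  \<comment> \<open>The second factor is independent of \<mu>, so dividing by the instance \<mu> = 1
    leaves d \<mu> / d 1, which is the bracket.\<close>
  have diff: "lat X (s + \<mu> / 2) - lat X (s - \<mu> / 2) = d \<mu> * (c1 * cpow l s - c2 * cpow l (- s))" for \<mu>
    using cpow_add[of l "- s" "\<mu> / 2"]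
    by (simp add: QLattice d_def cpow_add cpow_diff algebra_simps)
  have "d 1 \<noteq> 0"
    using assms cpow_half_diff_nonzero[of l 1] by (auto simp: QLattice d_def)
  moreover have "bracket X \<mu> = d \<mu> / d 1"
    by (simp add: QLattice d_def)
  ultimately show ?thesis
    by (simp add: diff)
qed

lemma gen_power_Suc_self: "gen_power X \<nu> s s (Suc n) = 0"
  by (simp add: gen_power_def prod.lessThan_Suc_shift del: prod.lessThan_Suc)

text \<open>The products at t and at t - 1 share n factors, namely
  \<open>gen_power X \<nu> s (t - 1) n\<close>. Only the first factor of one and the last factor of
  the other differ, and x_\<nu>(s) cancels between them.\<close>

lemma nabla_gen_power:
  assumes "nonuniform_lattice X"
  shows "nabla (\<lambda>t. gen_power X \<nu> s t (Suc n)) t =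
    - bracket X (of_nat (Suc n)) * gen_power X \<nu> s (t - 1) n * nabla (lat_shift X (\<nu> - of_nat n)) t"
proof -
  \<comment> \<open>The midpoint of the arguments of the two unshared factors, which lie n + 1
    apart. The increment of x_(\<nu>-n) at t is centred at the same point, which explains the
    shifted index.\<close>
  define u where "u = t + (\<nu> - of_nat (Suc n)) / 2"
  have "t + \<nu> / 2 = u + of_nat (Suc n) / 2" "t - of_nat (Suc n) + \<nu> / 2 = u - of_nat (Suc n) / 2"
    "t + (\<nu> - of_nat n) / 2 = u + 1 / 2" "t - 1 + (\<nu> - of_nat n) / 2 = u - 1 / 2"
    by (simp_all add: u_def field_simps)
  then have outer: "lat_shift X \<nu> t - lat_shift X \<nu> (t - of_nat (Suc n)) =
      bracket X (of_nat (Suc n)) * nabla (lat_shift X (\<nu> - of_nat n)) t"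
    using lat_symmetric_difference[OF assms, of u "of_nat (Suc n)"]
    by (simp only: lat_shift_def nabla_def)
  have "gen_power X \<nu> s t (Suc n) = (lat_shift X \<nu> s - lat_shift X \<nu> t) * gen_power X \<nu> s (t - 1) n"
    by (simp add: gen_power_def prod.lessThan_Suc_shift algebra_simps del: prod.lessThan_Suc)
  moreover have "gen_power X \<nu> s (t - 1) (Suc n) =
      gen_power X \<nu> s (t - 1) n * (lat_shift X \<nu> s - lat_shift X \<nu> (t - of_nat (Suc n)))"
    by (simp add: gen_power_def algebra_simps)
  ultimately have "nabla (\<lambda>t. gen_power X \<nu> s t (Suc n)) t =
      - (lat_shift X \<nu> t - lat_shift X \<nu> (t - of_nat (Suc n))) * gen_power X \<nu> s (t - 1) n"
    by (simp add: nabla_def algebra_simps)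
  then show ?thesis
    unfolding outer by simp
qed

text \<open>Injectivity of \<open>of_nat\<close> into the complex numbers turns the existentially
  defined set into an index range, where induction on n applies.\<close>

lemma sum_steps: "(\<Sum>t\<in>steps a (a + of_nat n). F t) = (\<Sum>m<n. F (a + of_nat (Suc m)))"
proof -
  have "steps a (a + of_nat n) = (\<lambda>m. a + of_nat (Suc m)) ` {..<n}"
  proof (intro equalityI subsetI)
    fix t assume "t \<in> steps a (a + of_nat n)"
    then obtain m k where t: "t = a + of_nat (Suc m)" "a + of_nat n = t + of_nat k"
      by (auto simp: steps_def)
    then have "(of_nat n :: complex) = of_nat (Suc m + k)"
      by simp
    then have "n = Suc m + k"
      using of_nat_eq_iff by blast
    with t show "t \<in> (\<lambda>m. a + of_nat (Suc m)) ` {..<n}"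
      by auto
  next
    fix t assume "t \<in> (\<lambda>m. a + of_nat (Suc m)) ` {..<n}"
    then obtain m where m: "t = a + of_nat (Suc m)" "m < n"
      by auto
    then have "n = Suc m + (n - Suc m)"
      by simp
    then have "a + of_nat n = t + of_nat (n - Suc m)"
      using m(1) by (metis add.assoc of_nat_add)
    with m show "t \<in> steps a (a + of_nat n)"
      unfolding steps_def by blast
  qed
  moreover have "inj_on (\<lambda>m. a + of_nat (Suc m)) {..<n}"
    by (auto simp: inj_on_def)
  ultimately show ?thesis
    by (simp add: sum.reindex)
qed

lemma sum_steps_nabla:
  "(\<Sum>t\<in>steps a (a + of_nat n). nabla F t) = F (a + of_nat n) - F a"
  unfolding sum_steps by (induction n) (simp_all add: nabla_def algebra_simps)

text \<open>The product rule for \<open>nabla\<close> is split so that w is taken at t - 1, matching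
  the kernel of \<open>nabla_sum\<close>; the left side of the rule then telescopes.\<close>

lemma sum_steps_by_parts:
  "(\<Sum>t\<in>steps a (a + of_nat n). w (t - 1) * nabla g t) =
    w (a + of_nat n) * g (a + of_nat n) - w a * g a -
    (\<Sum>t\<in>steps a (a + of_nat n). g t * nabla w t)"
proof -
  have "nabla (\<lambda>t. w t * g t) t = w (t - 1) * nabla g t + g t * nabla w t" for t
    by (simp add: nabla_def algebra_simps)
  then show ?thesis
    using sum_steps_nabla[of "\<lambda>t. w t * g t" a n] by (simp add: sum.distrib algebra_simps)
qed

lemma nabla_sum_nabla_lat:
  assumes "\<forall>t\<in>steps a z. nabla (lat_shift X \<gamma>) t \<noteq> 0"
  shows "nabla_sum X a \<gamma> k (nabla_lat X \<gamma> g) z =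
    1 / bracket_fact X (k - 1) *
    (\<Sum>t\<in>steps a z. gen_power X (\<gamma> + of_nat k - 1) z (t - 1) (k - 1) * nabla g t)"
  using assms by (simp add: nabla_sum_def nabla_lat_def)

lemma nabla_sum_Suc_nabla_lat:
  assumes "nonuniform_lattice X"
    and "\<forall>t\<in>steps a (a + of_nat n). nabla (lat_shift X \<gamma>) t \<noteq> 0"
  shows "nabla_sum X a \<gamma> (Suc (Suc k)) (nabla_lat X \<gamma> g) (a + of_nat n) =
    nabla_sum X a (\<gamma> + 1) (Suc k) g (a + of_nat n) -
    1 / bracket_fact X (Suc k) * g a * gen_power X (\<gamma> + of_nat (Suc k)) (a + of_nat n) a (Suc k)"
proof -
  \<comment> \<open>Both iterated sums have kernel index \<nu>, since \<gamma> + (k+2) - 1 =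
    (\<gamma>+1) + (k+1) - 1. Moreover \<nu> - k = \<gamma> + 1, so differencing the kernel produces
    exactly the weights of the sum with index \<gamma> + 1.\<close>
  define z \<nu> S where "z = a + of_nat n" and "\<nu> = \<gamma> + of_nat (Suc k)"
    and "S = (\<Sum>t\<in>steps a z. gen_power X \<nu> z (t - 1) k * g t * nabla (lat_shift X (\<gamma> + 1)) t)"
  have "(\<Sum>t\<in>steps a z. gen_power X \<nu> z (t - 1) (Suc k) * nabla g t) =
      - (gen_power X \<nu> z a (Suc k) * g a) -
      (\<Sum>t\<in>steps a z. g t * nabla (\<lambda>t. gen_power X \<nu> z t (Suc k)) t)"
    using sum_steps_by_parts[of "\<lambda>t. gen_power X \<nu> z t (Suc k)" g a n, folded z_def]
    by (simp add: gen_power_Suc_self)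
  also have "(\<Sum>t\<in>steps a z. g t * nabla (\<lambda>t. gen_power X \<nu> z t (Suc k)) t) =
      - bracket X (of_nat (Suc k)) * S"
    by (simp add: nabla_gen_power[OF assms(1)] S_def \<nu>_def sum_distrib_left algebra_simps
        flip: sum_negf)
  finally have parts: "(\<Sum>t\<in>steps a z. gen_power X \<nu> z (t - 1) (Suc k) * nabla g t) =
      bracket X (of_nat (Suc k)) * S - gen_power X \<nu> z a (Suc k) * g a"
    by simp
  have "nabla_sum X a \<gamma> (Suc (Suc k)) (nabla_lat X \<gamma> g) z =
      1 / bracket_fact X (Suc k) *
      (\<Sum>t\<in>steps a z. gen_power X \<nu> z (t - 1) (Suc k) * nabla g t)"
    using nabla_sum_nabla_lat[OF assms(2), of "Suc (Suc k)" g] by (simp add: z_def \<nu>_def algebra_simps)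
  moreover have "nabla_sum X a (\<gamma> + 1) (Suc k) g z = 1 / bracket_fact X k * S"
    by (simp add: nabla_sum_def S_def \<nu>_def algebra_simps)
  \<comment> \<open>The bracket from differencing the kernel lowers the factorial by one
    step.\<close>
  moreover have "1 / bracket_fact X (Suc k) * (bracket X (of_nat (Suc k)) * S) = 1 / bracket_fact X k * S"
    using bracket_of_nat_nonzero[OF assms(1), of "Suc k"] by (simp add: bracket_fact_Suc)
  ultimately have "nabla_sum X a \<gamma> (Suc (Suc k)) (nabla_lat X \<gamma> g) z =
      nabla_sum X a (\<gamma> + 1) (Suc k) g z - 1 / bracket_fact X (Suc k) * (gen_power X \<nu> z a (Suc k) * g a)"
    by (simp only: parts right_diff_distrib)
  then show ?thesis
    by (simp only: z_def \<nu>_def mult_ac)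
qed

text \<open>Peeling off the outermost quotient raises \<gamma> by 1, so the induction must leave
  \<gamma> arbitrary.\<close>

lemma taylor_Suc:
  assumes "nonuniform_lattice X"
    and "\<forall>i\<le>k. \<forall>t\<in>steps a (a + of_nat n). nabla (lat_shift X (\<gamma> + of_nat i)) t \<noteq> 0"
  shows "nabla_sum X a \<gamma> (Suc k) (nabla_pow X \<gamma> (Suc k) f) (a + of_nat n) =
    f (a + of_nat n) - (\<Sum>j\<le>k. 1 / bracket_fact X j
      * nabla_pow X (\<gamma> + of_nat (Suc k) - of_nat j) j f a
      * gen_power X (\<gamma> + of_nat k) (a + of_nat n) a j)"
  using assms(2)
proof (induction k arbitrary: \<gamma>)
  case 0
  then show ?case
    \<comment> \<open>For a single sum the kernel is the empty product, and the sum telescopes to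
      f(z) - f(a).\<close>
    using nabla_sum_nabla_lat[of a "a + of_nat n" X \<gamma> 1 f] sum_steps_nabla[of f a n]
    by (simp add: gen_power_def bracket_fact_def)
next
  case (Suc k)
  define g where "g = nabla_pow X (\<gamma> + 1) (Suc k) f"
  have "\<forall>i\<le>k. \<forall>t\<in>steps a (a + of_nat n). nabla (lat_shift X (\<gamma> + 1 + of_nat i)) t \<noteq> 0"
    using Suc.prems by (metis Suc_le_mono add.assoc of_nat_Suc)
  note IH = Suc.IH[OF this, folded g_def]
  have "\<forall>t\<in>steps a (a + of_nat n). nabla (lat_shift X \<gamma>) t \<noteq> 0"
    using Suc.prems[rule_format, of 0] by simp
  from nabla_sum_Suc_nabla_lat[OF assms(1) this, of k g]
  have "nabla_sum X a \<gamma> (Suc (Suc k)) (nabla_pow X \<gamma> (Suc (Suc k)) f) (a + of_nat n) =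
    nabla_sum X a (\<gamma> + 1) (Suc k) g (a + of_nat n) -
    1 / bracket_fact X (Suc k) * g a * gen_power X (\<gamma> + of_nat (Suc k)) (a + of_nat n) a (Suc k)"
    by (simp add: g_def)
  \<comment> \<open>This identifies g(a) as the coefficient of the new top term j = k + 1.\<close>
  moreover have "\<gamma> + of_nat (Suc (Suc k)) - of_nat (Suc k) = \<gamma> + 1"
    by simp
  \<comment> \<open>The sum of \<gamma> and the order is unchanged by the step, so the terms j \<le>
    k of the induction hypothesis are already those of the larger expansion.\<close>
  moreover have "\<gamma> + 1 + of_nat (Suc k) = \<gamma> + of_nat (Suc (Suc k))"
    "\<gamma> + 1 + of_nat k = \<gamma> + of_nat (Suc k)"
    by simp_all
  ultimately show ?case
    using IH unfolding sum.atMost_Suc g_def by (simp only: diff_diff_eq)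
qed

text \<open>Restricts the increment condition, posed on {a-i+1, ..., z}, to {a+1, ..., z}, where the
  cancellations take place.\<close>

lemma steps_subset: "steps a z \<subseteq> steps (a - of_nat i) z"
proof
  fix t assume "t \<in> steps a z"
  then obtain m n where "t = a + of_nat (Suc m)" and z: "z = t + of_nat n"
    by (auto simp: steps_def)
  then have "t = a - of_nat i + of_nat (Suc (m + i))"
    by simp
  with z show "t \<in> steps (a - of_nat i) z"
    unfolding steps_def by blast
qed

theorem theorem23:
  fixes X :: lattice and a \<gamma> :: complex and k :: nat
    and f :: "complex \<Rightarrow> complex" and z :: complex
  assumes "nonuniform_lattice X"
    and "k \<ge> 1"
    and "z \<in> {a + of_nat n | n. n \<ge> 1}"
    and "increments_nonzero X a \<gamma> k z"
  shows "nabla_sum X a \<gamma> k (nabla_pow X \<gamma> k f) z =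
    f z - (\<Sum>j = 0..k - 1. 1 / bracket_fact X j
             * nabla_pow X (\<gamma> + of_nat k - of_nat j) j f a
             * gen_power X (\<gamma> + of_nat k - 1) z a j)"
proof -
  obtain n where z: "z = a + of_nat n"
    using assms(3) by blast
  obtain m where k: "k = Suc m"
    using assms(2) by (cases k) auto
  have "\<forall>i\<le>m. \<forall>t\<in>steps a (a + of_nat n). nabla (lat_shift X (\<gamma> + of_nat i)) t \<noteq> 0"
    using assms(4) steps_subset unfolding increments_nonzero_def k z
    by (metis le_imp_less_Suc subsetD)
  from taylor_Suc[OF assms(1) this, of f]
  have "nabla_sum X a \<gamma> k (nabla_pow X \<gamma> k f) z =
    f z - (\<Sum>j\<le>m. 1 / bracket_fact X j
             * nabla_pow X (\<gamma> + of_nat k - of_nat j) j f a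
             * gen_power X (\<gamma> + of_nat m) z a j)"
    unfolding k z .
  moreover have "\<gamma> + of_nat k - 1 = \<gamma> + of_nat m"
    by (simp add: k)
  ultimately show ?thesis
    by (simp only: k diff_Suc_1 atMost_atLeast0)
qed

end
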